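(* Let $\mathbf{A}=(A_1,A_2)\in C^{\infty}(\mathbb{T}^2;\mathbb{R}^2)$ and let $\omega$ be an open subset of $\mathbb{T}^2$. The following two assertions are equivalent. (i) (MGCC) holds, i.e. for every periodic direction $\vec{\gamma}$, $\omega_{\vec{\gamma}^{\perp}}$ contains all the critical points of $A_{\gamma}$. (ii) For every periodic direction $\vec{\gamma}$, $\omega_{\vec{\gamma}^{\perp}}$ contains all the zeros of $\langle B\rangle_{\gamma}$.
   Context: $\mathbb{T}^2=\mathbb{R}^2/(2\pi\mathbb{Z})^2$. A periodic direction is a unit vector $\vec\gamma\in\mathbb{R}^2$ parallel to a nonzero vector of $\mathbb{Z}^2$, so that all geodesics $t\mapsto z+t\vec\gamma$ on $\mathbb{T}^2$ are closed. For an integrable (scalar or vector-valued) $f$ on $\mathbb{T}^2$, $\langle f\rangle_{\vec\gamma}(z):=\lim_{T\to\infty}\frac1T\int_0^T f(z+t\vec\gamma)\,dt$. Define the scalar function $A_\gamma:=\langle \mathbf{A}\rangle_{\vec\gamma}\cdot\vec\gamma$; it is constant along the direction $\vec\gamma$ and is identified with a function of the transversal variable (direction $\vec\gamma^{\perp}$). The magnetic field is the scalar function $B=\partial_xA_2-\partial_yA_1$ and $\langle B\rangle_\gamma(z):=\lim_{T\to\infty}\frac1T\int_0^T B(z+t\vec\gamma)\,dt$, which is likewise constant along $\vec\gamma$ and identified with a function of the transversal variable. $\omega_{\vec\gamma^\perp}$ is the projection of $\omega$ on the direction $\vec\gamma^\perp$, i.e. its image in the quotient of $\mathbb{T}^2$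 by the closed geodesics of direction $\vec\gamma$ (a circle). Thus "$\omega_{\vec\gamma^\perp}$ contains all critical points of $A_\gamma$" means: for every $z\in\mathbb{T}^2$ with $\nabla A_\gamma(z)=0$, $\{z+t\vec\gamma:t\in\mathbb{R}\}\cap\omega\neq\emptyset$; and "$\omega_{\vec\gamma^\perp}$ contains all zeros of $\langle B\rangle_\gamma$" means the same for every $z$ with $\langle B\rangle_\gamma(z)=0$. *)

theory Defs
  imports "HOL-Analysis.Analysis"
begin

text \<open>
  The torus is \<open>\<real>\<^sup>2 / (2\<pi>\<int>)\<^sup>2\<close>. Functions on it, subsets of it and points of it are represented by
  their lifts to \<^typ>\<open>real^2\<close>; a subset is given through its (periodic) membership predicate.
\<close>

definition torus_periodic :: "(real^2 \<Rightarrow> 'b) \<Rightarrow> bool" where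
  "torus_periodic f \<longleftrightarrow>
     (\<forall>z k. (\<forall>i. k $ i \<in> \<int>) \<longrightarrow> f (z + (2 * pi) *\<^sub>R k) = f z)"

text \<open>The \<^emph>\<open>lift\<close> of an open subset of the torus; the topology on the torus is the quotient one.\<close>

definition torus_open :: "(real^2) set \<Rightarrow> bool" where
  "torus_open \<omega> \<longleftrightarrow> torus_periodic (\<lambda>z. z \<in> \<omega>) \<and> open \<omega>"

primrec C_times :: "nat \<Rightarrow> ('a::real_normed_vector \<Rightarrow> 'b::real_normed_vector) \<Rightarrow> bool" where
  "C_times 0 f \<longleftrightarrow> continuous_on UNIV f"
| "C_times (Suc k) f \<longleftrightarrow>
     (\<forall>z. f differentiable (at z)) \<and> (\<forall>v. C_times k (\<lambda>z. frechet_derivative f (at z) v))"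

definition torus_smooth :: "(real^2 \<Rightarrow> 'b::real_normed_vector) \<Rightarrow> bool" where
  "torus_smooth f \<longleftrightarrow> torus_periodic f \<and> (\<forall>k. C_times k f)"

definition periodic_direction :: "real^2 \<Rightarrow> bool" where
  "periodic_direction \<gamma> \<longleftrightarrow>
     norm \<gamma> = 1 \<and> (\<exists>k c. (\<forall>i. k $ i \<in> \<int>) \<and> k \<noteq> 0 \<and> \<gamma> = c *\<^sub>R k)"

definition dir_average ::
    "real^2 \<Rightarrow> (real^2 \<Rightarrow> 'b::euclidean_space) \<Rightarrow> real^2 \<Rightarrow> 'b" where
  "dir_average \<gamma> f z = Lim at_top (\<lambda>T. (1 / T) *\<^sub>R integral {0..T} (\<lambda>t. f (z + t *\<^sub>R \<gamma>)))"

definition A_gamma :: "(real^2 \<Rightarrow> real^2) \<Rightarrow> real^2 \<Rightarrow> real^2 \<Rightarrow> real" where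
  "A_gamma A \<gamma> z = dir_average \<gamma> A z \<bullet> \<gamma>"

definition partial_deriv :: "2 \<Rightarrow> (real^2 \<Rightarrow> real) \<Rightarrow> real^2 \<Rightarrow> real" where
  "partial_deriv i f z = deriv (\<lambda>s. f (z + s *\<^sub>R axis i 1)) 0"

definition magnetic_field :: "(real^2 \<Rightarrow> real^2) \<Rightarrow> real^2 \<Rightarrow> real" where
  "magnetic_field A z =
     partial_deriv 1 (\<lambda>w. A w $ 2) z - partial_deriv 2 (\<lambda>w. A w $ 1) z"

definition critical_points :: "(real^2 \<Rightarrow> real) \<Rightarrow> (real^2) set" where
  "critical_points f = {z. GDERIV f z :> 0}"

text \<open>
  The projection of \<open>\<omega>\<close> along \<open>\<gamma>\<close> lives in the quotient of the torus by the closed geodesics of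
  direction \<open>\<gamma>\<close>. It is represented by its preimage: the points whose geodesic of direction \<open>\<gamma>\<close>
  meets \<open>\<omega>\<close>. As \<open>\<omega>\<close> is periodic, it does not matter whether the geodesic is taken on the torus or
  on the plane.
\<close>

definition perp_projection :: "real^2 \<Rightarrow> (real^2) set \<Rightarrow> (real^2) set" where
  "perp_projection \<gamma> \<omega> = {z. {z + t *\<^sub>R \<gamma> | t. True} \<inter> \<omega> \<noteq> {}}"

definition MGCC :: "(real^2 \<Rightarrow> real^2) \<Rightarrow> (real^2) set \<Rightarrow> bool" where
  "MGCC A \<omega> \<longleftrightarrow>
     (\<forall>\<gamma>. periodic_direction \<gamma> \<longrightarrow> critical_points (A_gamma A \<gamma>) \<subseteq> perp_projection \<gamma> \<omega>)"

end

theory Submission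
  imports Defs
begin

text \<open>
  Write \<open>w = \<gamma>\<^sup>\<bottom>\<close>. The identity \<open>\<nabla>(A \<bullet> \<gamma>) = (\<gamma> \<bullet> \<nabla>) A - B w\<close>, averaged along the closed geodesics of
  direction \<open>\<gamma>\<close>, gives \<open>\<nabla>A\<^sub>\<gamma> = - \<langle>B\<rangle>\<^sub>\<gamma> w\<close>, because \<open>(\<gamma> \<bullet> \<nabla>) A\<close> integrates to zero over a period.
  Hence the critical points of \<open>A\<^sub>\<gamma>\<close> are exactly the zeros of \<open>\<langle>B\<rangle>\<^sub>\<gamma>\<close>.
\<close>

lemma integral_periodic_shift:
  fixes h :: "real \<Rightarrow> 'b::euclidean_space"
  assumes cont: "continuous_on UNIV h" and per: "\<And>t. h (t + L) = h t"
    and "0 \<le> L" "0 \<le> T"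
  shows "integral {0..T + L} h = integral {0..T} h + integral {0..L} h"
proof -
  have "integral {0..T} h = integral {0..T} (h \<circ> (\<lambda>t. t + L))"
    by (simp add: o_def per)
  also have "\<dots> = integral {0 + L..T + L} h"
    by (rule integral_shift) (rule continuous_on_subset[OF cont subset_UNIV])
  finally have "integral {0..T} h = integral {L..T + L} h"
    by simp
  moreover have "integral {0..L} h + integral {L..T + L} h = integral {0..T + L} h"
    using \<open>0 \<le> L\<close> \<open>0 \<le> T\<close>
    by (intro Henstock_Kurzweil_Integration.integral_combine integrable_continuous_interval
        continuous_on_subset[OF cont]) auto
  ultimately show ?thesis
    by (simp add: add.commute)
qed

text \<open>The integral up to \<open>T\<close> grows linearly with slope given by its mean over one
  period. The deviation \<open>P\<close> from this growth is periodic and continuous on a period,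
  hence bounded, so dividing it by \<open>T\<close> makes it vanish in the limit.\<close>

lemma average_tendsto_periodic:
  fixes h :: "real \<Rightarrow> 'b::euclidean_space"
  assumes cont: "continuous_on UNIV h" and per: "\<And>t. h (t + L) = h t" and L: "0 < L"
  shows "((\<lambda>T. (1 / T) *\<^sub>R integral {0..T} h) \<longlongrightarrow> (1 / L) *\<^sub>R integral {0..L} h) at_top"
proof -
  define P where "P T = integral {0..T} h - (T / L) *\<^sub>R integral {0..L} h" for T
  have P_shift: "P (s + real n * L) = P s" if "0 \<le> s" for s n
  proof (induction n)
    case (Suc n)
    have "P (s + real n * L + L) = P (s + real n * L)"
      using integral_periodic_shift[OF cont per, of "s + real n * L"] L that
      by (simp add: P_def add_divide_distrib scaleR_add_left)
    with Suc show ?case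
      by (simp add: algebra_simps)
  qed simp
  have "continuous_on {0..L} (\<lambda>T. integral {0..T} h)"
    by (intro indefinite_integral_continuous_1 integrable_continuous_interval
        continuous_on_subset[OF cont]) simp
  then have "continuous_on {0..L} P"
    unfolding P_def using L by (intro continuous_intros) auto
  then have "bounded (P ` {0..L})"
    by (intro compact_imp_bounded compact_continuous_image) auto
  then obtain M where M: "\<And>s. s \<in> {0..L} \<Longrightarrow> norm (P s) \<le> M"
    unfolding bounded_iff by blast
  have P_bound: "norm (P T) \<le> M" if "0 \<le> T" for T
  proof -
    \<comment> \<open>\<open>n\<close> counts the full periods in \<open>{0..T}\<close>; removing
      them moves \<open>T\<close> into \<open>{0..L}\<close>, where compactness provides the bound
      \<open>M\<close>.\<close>
    define n where "n = nat \<lfloor>T / L\<rfloor>"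
    have n: "real n \<le> T / L" "T / L < real n + 1"
      using that L by (auto simp: n_def)
    then have "T - real n * L \<in> {0..L}"
      using L by (auto simp: field_simps)
    then show ?thesis
      using M P_shift[of "T - real n * L" n] by force
  qed
  have "((\<lambda>T. (1 / T) *\<^sub>R P T) \<longlongrightarrow> 0) at_top"
  proof (rule Lim_null_comparison)
    show "\<forall>\<^sub>F T in at_top. norm ((1 / T) *\<^sub>R P T) \<le> M / T"
      using eventually_gt_at_top[of 0]
      by eventually_elim (use P_bound in \<open>auto intro!: divide_right_mono\<close>)
    show "((\<lambda>T. M / T) \<longlongrightarrow> 0) at_top"
      by (intro real_tendsto_divide_at_top[OF tendsto_const] filterlim_ident)
  qed
  then have "((\<lambda>T. (1 / T) *\<^sub>R P T + (1 / L) *\<^sub>R integral {0..L} h) \<longlongrightarrow>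
      0 + (1 / L) *\<^sub>R integral {0..L} h) at_top"
    by (intro tendsto_intros)
  moreover have "\<forall>\<^sub>F T in at_top. (1 / T) *\<^sub>R P T + (1 / L) *\<^sub>R integral {0..L} h =
      (1 / T) *\<^sub>R integral {0..T} h"
    using eventually_gt_at_top[of 0]
    by eventually_elim (auto simp: P_def algebra_simps)
  ultimately show ?thesis
    by (simp add: tendsto_cong)
qed

text \<open>A step of length \<open>2 * pi / \<bar>c\<bar>\<close> along \<gamma> is a translation
  by \<open>2 * pi\<close> times an integer vector, so it closes up on the torus.\<close>

lemma periodic_direction_period:
  assumes "periodic_direction \<gamma>"
  obtains L where "0 < L"
    "\<And>(f :: real^2 \<Rightarrow> 'b) z. torus_periodic f \<Longrightarrow> f (z + L *\<^sub>R \<gamma>) = f z"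
proof -
  obtain k c where k: "\<forall>i. k $ i \<in> \<int>" and \<gamma>: "\<gamma> = c *\<^sub>R k" and "norm \<gamma> = 1"
    using assms by (auto simp: periodic_direction_def)
  then have "c \<noteq> 0"
    by auto
  \<comment> \<open>The sign of \<open>c\<close> is absorbed into the integer vector, so that the
    period is positive.\<close>
  define k' where "k' = sgn c *\<^sub>R k"
  have "\<forall>i. k' $ i \<in> \<int>"
    using k by (auto simp: k'_def sgn_if)
  moreover have "(2 * pi / \<bar>c\<bar>) *\<^sub>R \<gamma> = (2 * pi) *\<^sub>R k'"
    using \<open>c \<noteq> 0\<close> by (auto simp: \<gamma> k'_def sgn_if abs_if)
  ultimately show thesis
    using that[of "2 * pi / \<bar>c\<bar>"] \<open>c \<noteq> 0\<close> by (auto simp: torus_periodic_def)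
qed

lemma continuous_on_line:
  fixes f :: "'a::real_normed_vector \<Rightarrow> 'b::topological_space"
  assumes "continuous_on UNIV f"
  shows "continuous_on S (\<lambda>t. f (z + t *\<^sub>R \<gamma>))"
  by (rule continuous_on_compose2[OF assms]) (auto intro!: continuous_intros)

text \<open>Replaces the limit in \<open>dir_average\<close> by an integral over a fixed compact
  interval, which can be differentiated in \<open>z\<close>.\<close>

lemma dir_average_period:
  fixes f :: "real^2 \<Rightarrow> 'b::euclidean_space"
  assumes "continuous_on UNIV f" and per: "\<And>z. f (z + L *\<^sub>R \<gamma>) = f z" and "0 < L"
  shows "dir_average \<gamma> f z = (1 / L) *\<^sub>R integral {0..L} (\<lambda>t. f (z + t *\<^sub>R \<gamma>))"
  unfolding dir_average_def
proof (intro tendsto_Lim average_tendsto_periodic)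
  show "f (z + (t + L) *\<^sub>R \<gamma>) = f (z + t *\<^sub>R \<gamma>)" for t
    using per[of "z + t *\<^sub>R \<gamma>"] by (simp add: algebra_simps)
qed (use assms in \<open>auto intro: continuous_on_line\<close>)

text \<open>Differentiation under the integral sign, justified by joint continuity of the gradient
  in the base point and in \<open>t\<close>.\<close>

lemma GDERIV_integral_line:
  fixes f :: "'a::euclidean_space \<Rightarrow> real"
  assumes grad: "\<And>z. GDERIV f z :> G z" and cont: "continuous_on UNIV G"
  shows "GDERIV (\<lambda>z. integral {a..b} (\<lambda>t. f (z + t *\<^sub>R \<gamma>))) z :>
    integral {a..b} (\<lambda>t. G (z + t *\<^sub>R \<gamma>))"
proof -
  have f_cont: "continuous_on UNIV f"
    using grad unfolding gderiv_def
    by (intro continuous_at_imp_continuous_on ballI) (rule has_derivative_continuous)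
  have "((\<lambda>z. integral (cbox a b) (\<lambda>t. f (z + t *\<^sub>R \<gamma>))) has_derivative
      integral (cbox a b) (\<lambda>t. blinfun_inner_left (G (z + t *\<^sub>R \<gamma>)))) (at z within UNIV)"
  proof (rule leibniz_rule)
    show "((\<lambda>z. f (z + t *\<^sub>R \<gamma>)) has_derivative
        blinfun_apply (blinfun_inner_left (G (y + t *\<^sub>R \<gamma>)))) (at y within UNIV)" for y t
    proof -
      have "((\<lambda>z. z + t *\<^sub>R \<gamma>) has_derivative (\<lambda>v. v)) (at y)"
        by (auto intro!: derivative_eq_intros)
      from has_derivative_compose[OF this grad[unfolded gderiv_def]] show ?thesis
        by simp
    qed
    show "(\<lambda>t. f (y + t *\<^sub>R \<gamma>)) integrable_on cbox a b" for y
      by (intro integrable_continuous continuous_on_line f_cont)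
    have "continuous_on (UNIV \<times> cbox a b) (\<lambda>p. G (fst p + snd p *\<^sub>R \<gamma>))"
      by (rule continuous_on_compose2[OF cont]) (auto intro!: continuous_intros)
    then show "continuous_on (UNIV \<times> cbox a b) (\<lambda>(y, t). blinfun_inner_left (G (y + t *\<^sub>R \<gamma>)))"
      unfolding case_prod_unfold
      by (rule bounded_linear.continuous_on[OF bounded_linear_blinfun_inner_left])
  qed auto
  \<comment> \<open>The Leibniz rule yields an integral of functionals; identifying vectors with
    functionals is bounded linear, so it commutes with the integral and leaves a gradient
    vector.\<close>
  moreover have "integral (cbox a b) (\<lambda>t. blinfun_inner_left (G (z + t *\<^sub>R \<gamma>))) =
      blinfun_inner_left (integral (cbox a b) (\<lambda>t. G (z + t *\<^sub>R \<gamma>)))"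
    using integral_linear[OF integrable_continuous[OF continuous_on_line[OF cont]]
        bounded_linear_blinfun_inner_left]
    by (simp add: o_def)
  ultimately show ?thesis
    by (simp add: gderiv_def)
qed

lemma partial_deriv_component:
  fixes A :: "real^2 \<Rightarrow> real^2"
  assumes "A differentiable (at z)"
  shows "partial_deriv i (\<lambda>w. A w $ j) z = frechet_derivative A (at z) (axis i 1) $ j"
proof -
  let ?D = "frechet_derivative A (at z)"
  have D: "(A has_derivative ?D) (at z)"
    using assms frechet_derivative_works by blast
  have "((\<lambda>s. z + s *\<^sub>R axis i 1) has_derivative (\<lambda>s. s *\<^sub>R axis i 1)) (at (0::real))"
    by (auto intro!: derivative_eq_intros)
  then have "((\<lambda>s. A (z + s *\<^sub>R axis i 1)) has_derivative (\<lambda>s. ?D (s *\<^sub>R axis i 1))) (at 0)"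
    by (rule has_derivative_compose) (use D in simp)
  then have "((\<lambda>s. A (z + s *\<^sub>R axis i 1) $ j) has_derivative (\<lambda>s. ?D (s *\<^sub>R axis i 1) $ j)) (at 0)"
    by (rule bounded_linear.has_derivative[OF bounded_linear_vec_nth])
  moreover have "(\<lambda>s. ?D (s *\<^sub>R axis i 1) $ j) = (*) (?D (axis i 1) $ j)"
    using D by (auto simp: linear_scale[OF has_derivative_linear])
  ultimately show ?thesis
    unfolding partial_deriv_def by (intro DERIV_imp_deriv) (simp add: has_field_derivative_def)
qed

text \<open>The vector \<open>w\<close> of the overview: \<gamma> rotated counterclockwise by a
  quarter turn.\<close>

definition perp :: "real^2 \<Rightarrow> real^2" where
  "perp \<gamma> = vector [- \<gamma> $ 2, \<gamma> $ 1]"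

text \<open>The gradient of \<open>A z \<bullet> \<gamma>\<close> applies the transposed Jacobian to
  \<gamma>, the directional derivative applies the Jacobian itself. Their difference is the
  antisymmetric part, which in dimension two has the single entry \<open>magnetic_field A z\<close>
  up to sign.\<close>

lemma GDERIV_inner_magnetic_field:
  fixes A :: "real^2 \<Rightarrow> real^2"
  assumes "A differentiable (at z)"
  shows "GDERIV (\<lambda>z. A z \<bullet> \<gamma>) z :>
    frechet_derivative A (at z) \<gamma> - magnetic_field A z *\<^sub>R perp \<gamma>"
proof -
  let ?D = "frechet_derivative A (at z)"
  have D: "(A has_derivative ?D) (at z)"
    using assms frechet_derivative_works by blast
  have D_expand: "?D v = (v $ 1) *\<^sub>R ?D (axis 1 1) + (v $ 2) *\<^sub>R ?D (axis 2 1)" for v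
  proof -
    have "v = (v $ 1) *\<^sub>R axis 1 1 + (v $ 2) *\<^sub>R axis 2 1"
      by (simp add: vec_eq_iff forall_2 axis_def)
    then have "?D v = ?D ((v $ 1) *\<^sub>R axis 1 1 + (v $ 2) *\<^sub>R axis 2 1)"
      by (rule arg_cong)
    then show ?thesis
      by (simp only: linear_add[OF has_derivative_linear[OF D]]
          linear_scale[OF has_derivative_linear[OF D]])
  qed
  have "?D v \<bullet> \<gamma> = v \<bullet> (?D \<gamma> - magnetic_field A z *\<^sub>R perp \<gamma>)" for v
    by (simp add: magnetic_field_def partial_deriv_component[OF assms] D_expand[of v]
        D_expand[of \<gamma>] inner_vec_def sum_2 perp_def algebra_simps)
  moreover have "((\<lambda>z. A z \<bullet> \<gamma>) has_derivative (\<lambda>v. ?D v \<bullet> \<gamma>)) (at z)"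
    using D by (rule has_derivative_inner_left)
  ultimately show ?thesis
    by (simp add: gderiv_def)
qed

lemma GDERIV_unique:
  assumes "GDERIV f z :> a" "GDERIV f z :> b"
  shows "a = b"
proof -
  have "(\<lambda>h. h \<bullet> a) = (\<lambda>h. h \<bullet> b)"
    using assms unfolding gderiv_def by (rule has_derivative_unique)
  then show ?thesis
    by (simp add: fun_eq_iff vector_eq_ldot)
qed

lemma GDERIV_A_gamma:
  fixes A :: "real^2 \<Rightarrow> real^2"
  assumes A: "torus_smooth A" and \<gamma>: "periodic_direction \<gamma>"
  shows "GDERIV (A_gamma A \<gamma>) z :> - dir_average \<gamma> (magnetic_field A) z *\<^sub>R perp \<gamma>"
proof -
  let ?B = "magnetic_field A" and ?D = "\<lambda>z. frechet_derivative A (at z)"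
  have "C_times 1 A" and per: "torus_periodic A"
    using A by (auto simp: torus_smooth_def)
  then have diff: "A differentiable (at z)" and D_cont: "continuous_on UNIV (\<lambda>z. ?D z v)" for z v
    by auto
  have A_cont: "continuous_on UNIV A"
    using diff by (simp add: continuous_on_eq_continuous_at differentiable_imp_continuous_within)
  have B_eq: "?B = (\<lambda>z. ?D z (axis 1 1) $ 2 - ?D z (axis 2 1) $ 1)"
    by (auto simp: magnetic_field_def partial_deriv_component[OF diff])
  have B_cont: "continuous_on UNIV ?B"
    unfolding B_eq by (intro continuous_intros D_cont)
  obtain L where L: "0 < L"
    and "\<And>(f :: real^2 \<Rightarrow> real^2) z. torus_periodic f \<Longrightarrow> f (z + L *\<^sub>R \<gamma>) = f z"
    using periodic_direction_period[OF \<gamma>] by blast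
  with per have A_per: "A (z + L *\<^sub>R \<gamma>) = A z" for z
    by blast
  \<comment> \<open>The partial derivatives defining the field only see \<open>A\<close> near the
    base point, so the shift must be removed for every displacement \<open>y\<close>.\<close>
  have "A (z + L *\<^sub>R \<gamma> + y) = A (z + y)" for z y
    using A_per[of "z + y"] by (simp add: add_ac)
  then have B_per: "?B (z + L *\<^sub>R \<gamma>) = ?B z" for z
    by (simp add: magnetic_field_def partial_deriv_def)
  have int_line: "(\<lambda>t. f (z + t *\<^sub>R \<gamma>)) integrable_on {0..L}"
    if "continuous_on UNIV f" for f :: "real^2 \<Rightarrow> 'b::euclidean_space" and z
    by (intro integrable_continuous_interval continuous_on_line that)
  \<comment> \<open>Moving the inner product inside the integral leaves a scalar integrand whose
    gradient is already known.\<close>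
  have A_gamma_eq: "A_gamma A \<gamma> = (\<lambda>z. (1 / L) *\<^sub>R integral {0..L} (\<lambda>t. A (z + t *\<^sub>R \<gamma>) \<bullet> \<gamma>))"
    using integral_linear[OF int_line[OF A_cont] bounded_linear_inner_left[of \<gamma>]]
    by (auto simp: A_gamma_def dir_average_period[OF A_cont A_per L] o_def)
  \<comment> \<open>The directional derivative is the \<open>t\<close>-derivative of
    \<open>A\<close> along the geodesic, so its integral is a difference of end values, which agree
    after one period.\<close>
  have "((\<lambda>t. ?D (z + t *\<^sub>R \<gamma>) \<gamma>) has_integral (A (z + L *\<^sub>R \<gamma>) - A (z + 0 *\<^sub>R \<gamma>))) {0..L}"
  proof (rule fundamental_theorem_of_calculus)
    fix t
    have "((\<lambda>s. z + s *\<^sub>R \<gamma>) has_derivative (\<lambda>s. s *\<^sub>R \<gamma>)) (at t within {0..L})"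
      by (auto intro!: derivative_eq_intros)
    from has_derivative_compose[OF this diff[unfolded frechet_derivative_works]]
    show "((\<lambda>s. A (z + s *\<^sub>R \<gamma>)) has_vector_derivative ?D (z + t *\<^sub>R \<gamma>) \<gamma>) (at t within {0..L})"
      by (simp add: has_vector_derivative_def linear_scale[OF linear_frechet_derivative[OF diff]])
  qed (use L in simp)
  then have D_int: "integral {0..L} (\<lambda>t. ?D (z + t *\<^sub>R \<gamma>) \<gamma>) = 0"
    by (simp add: A_per integral_unique)
  have B_int: "integral {0..L} (\<lambda>t. ?B (z + t *\<^sub>R \<gamma>) *\<^sub>R perp \<gamma>) =
      integral {0..L} (\<lambda>t. ?B (z + t *\<^sub>R \<gamma>)) *\<^sub>R perp \<gamma>"
    using integral_linear[OF int_line[OF B_cont] bounded_linear_scaleR_left[of "perp \<gamma>"]]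
    by (simp add: o_def)
  have "integral {0..L} (\<lambda>t. ?D (z + t *\<^sub>R \<gamma>) \<gamma> - ?B (z + t *\<^sub>R \<gamma>) *\<^sub>R perp \<gamma>) =
      - integral {0..L} (\<lambda>t. ?B (z + t *\<^sub>R \<gamma>)) *\<^sub>R perp \<gamma>"
    using D_int B_int
    by (subst integral_diff) (auto intro!: int_line D_cont continuous_intros B_cont)
  moreover have "GDERIV (\<lambda>z. integral {0..L} (\<lambda>t. A (z + t *\<^sub>R \<gamma>) \<bullet> \<gamma>)) z :>
      integral {0..L} (\<lambda>t. ?D (z + t *\<^sub>R \<gamma>) \<gamma> - ?B (z + t *\<^sub>R \<gamma>) *\<^sub>R perp \<gamma>)"
    by (rule GDERIV_integral_line[OF GDERIV_inner_magnetic_field[OF diff]])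
      (intro continuous_intros D_cont B_cont)
  ultimately have "((\<lambda>z. integral {0..L} (\<lambda>t. A (z + t *\<^sub>R \<gamma>) \<bullet> \<gamma>)) has_derivative
      (\<lambda>h. h \<bullet> (- integral {0..L} (\<lambda>t. ?B (z + t *\<^sub>R \<gamma>)) *\<^sub>R perp \<gamma>))) (at z)"
    by (simp add: gderiv_def)
  from has_derivative_scaleR_right[OF this, of "1 / L"] show ?thesis
    by (simp add: gderiv_def A_gamma_eq dir_average_period[OF B_cont B_per L])
qed

text \<open>The gradient exists everywhere and is a scalar multiple of the nonzero vector
  \<open>perp \<gamma>\<close>; as gradients are unique, it is zero exactly when the scalar
  is.\<close>

lemma critical_points_A_gamma:
  fixes A :: "real^2 \<Rightarrow> real^2"
  assumes "torus_smooth A" and \<gamma>: "periodic_direction \<gamma>"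
  shows "critical_points (A_gamma A \<gamma>) = {z. dir_average \<gamma> (magnetic_field A) z = 0}"
proof -
  have "perp \<gamma> \<noteq> 0"
  proof
    assume "perp \<gamma> = 0"
    then have "\<gamma> = 0"
      by (simp add: perp_def vec_eq_iff forall_2)
    with \<gamma> show False
      by (simp add: periodic_direction_def)
  qed
  have "GDERIV (A_gamma A \<gamma>) z :> 0 \<longleftrightarrow> dir_average \<gamma> (magnetic_field A) z = 0" for z
    using GDERIV_A_gamma[OF assms, of z] GDERIV_unique \<open>perp \<gamma> \<noteq> 0\<close> by fastforce
  then show ?thesis
    by (simp add: critical_points_def)
qed

theorem proposition1p3:
  fixes A :: "real^2 \<Rightarrow> real^2" and \<omega> :: "(real^2) set"
  assumes "torus_smooth A"
    and "torus_open \<omega>"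
  shows "MGCC A \<omega> \<longleftrightarrow>
    (\<forall>\<gamma>. periodic_direction \<gamma> \<longrightarrow>
      {z. dir_average \<gamma> (magnetic_field A) z = 0} \<subseteq> perp_projection \<gamma> \<omega>)"
  \<comment> \<open>Direction by direction, both assertions are the same inclusion.\<close>
  by (simp add: MGCC_def critical_points_A_gamma[OF assms(1)])

end
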